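(* Let $K\ge1$, let $s_1,\dots,s_K\in\mathbb{R}$, $\alpha_1,\dots,\alpha_K>0$ and $\bar c>0$, and consider the scalar truncated least squares problem $$\hat s=\arg\min_{s\in\mathbb{R}} f_s(s),\qquad f_s(s)=\sum_{k=1}^K\min\left(\frac{(s-s_k)^2}{\alpha_k^2},\ \bar c^2\right).$$ For $s\in\mathbb{R}$ define the consensus set of $s$ as $\mathcal I(s)=\{k:\ (s-s_k)^2/\alpha_k^2\le\bar c^2\}$. Then, as $s$ ranges over $\mathbb{R}$, there are at most $2K-1$ different non-empty consensus sets. If these sets are named $\mathcal I_1,\dots,\mathcal I_{2K-1}$ (with repetitions if there are fewer), then the solution of the problem can be computed by enumeration as $$\hat s=\arg\min\left\{f_s(\hat s_i):\ \hat s_i=\Big(\sum_{k\in\mathcal I_i}\frac1{\alpha_k^2}\Big)^{-1}\sum_{k\in\mathcal I_i}\frac{s_k}{\alpha_k^2},\ \ i=1,\dots,2K-1\right\}.$$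
   Context: Here $\hat s=\arg\min\{f_s(\hat s_i):\dots\}$ means: a candidate $\hat s_i$ with the smallest value $f_s(\hat s_i)$ among all candidates is a global minimizer of $f_s$ over $\mathbb{R}$. *)

theory Defs
  imports Complex_Main
begin

definition tls_cost :: "nat \<Rightarrow> (nat \<Rightarrow> real) \<Rightarrow> (nat \<Rightarrow> real) \<Rightarrow> real \<Rightarrow> real \<Rightarrow> real" where
  "tls_cost K s \<alpha> c t = (\<Sum>k=1..K. min ((t - s k)\<^sup>2 / (\<alpha> k)\<^sup>2) (c\<^sup>2))"

definition consensus_set :: "nat \<Rightarrow> (nat \<Rightarrow> real) \<Rightarrow> (nat \<Rightarrow> real) \<Rightarrow> real \<Rightarrow> real \<Rightarrow> nat set" where
  "consensus_set K s \<alpha> c t = {k \<in> {1..K}. (t - s k)\<^sup>2 / (\<alpha> k)\<^sup>2 \<le> c\<^sup>2}"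

definition consensus_sets :: "nat \<Rightarrow> (nat \<Rightarrow> real) \<Rightarrow> (nat \<Rightarrow> real) \<Rightarrow> real \<Rightarrow> nat set set" where
  "consensus_sets K s \<alpha> c = {A. A \<noteq> {} \<and> (\<exists>t::real. A = consensus_set K s \<alpha> c t)}"

definition consensus_estimate :: "(nat \<Rightarrow> real) \<Rightarrow> (nat \<Rightarrow> real) \<Rightarrow> nat set \<Rightarrow> real" where
  "consensus_estimate s \<alpha> A = inverse (\<Sum>k\<in>A. 1 / (\<alpha> k)\<^sup>2) * (\<Sum>k\<in>A. s k / (\<alpha> k)\<^sup>2)"

end

theory Submission
  imports Defs
begin

text \<open>
  The \<open>k\<close>-th measurement belongs to the consensus set of \<open>t\<close> iff \<open>t\<close> lies in the interval
  \<open>[s\<^sub>k - \<alpha>\<^sub>k c, s\<^sub>k + \<alpha>\<^sub>k c]\<close>. As \<open>t\<close> increases, the number of left endpoints reached plus the number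
  of right endpoints passed is a nondecreasing integer between \<open>0\<close> and \<open>2K\<close> that determines the
  consensus set, and the set is empty at both extreme values; this leaves \<open>2K - 1\<close> values.
  For optimality, freezing the consensus set of \<open>t\<close> turns the cost into a weighted least squares
  problem that agrees with the cost at \<open>t\<close>, dominates it everywhere, and is minimized by
  the weighted mean.
\<close>

lemma nonempty_stabbing_sets:
  fixes l r :: "'a \<Rightarrow> 'b::linorder"
  assumes fin: "finite A" and lr: "\<And>k. k \<in> A \<Longrightarrow> l k \<le> r k"
  defines "\<S> \<equiv> {C. C \<noteq> {} \<and> (\<exists>t. C = {k \<in> A. l k \<le> t \<and> t \<le> r k})}"
  shows "finite \<S>" and "card \<S> \<le> 2 * card A - 1"
proof -
  define L where "L t = {k \<in> A. l k \<le> t}" for t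
  define R where "R t = {k \<in> A. r k < t}" for t
  define C where "C t = {k \<in> A. l k \<le> t \<and> t \<le> r k}" for t
  define g where "g t = card (L t) + card (R t)" for t
  define T where "T = {t. C t \<noteq> {}}"
  have finL: "finite (L t)" and finR: "finite (R t)" for t
    using fin by (auto simp: L_def R_def)
  have CLR: "C t = L t - R t" for t
    by (auto simp: C_def L_def R_def)
  have S: "\<S> = C ` T"
    by (auto simp: \<S>_def T_def C_def)
  \<comment> \<open>Both summands of \<open>g\<close> are nondecreasing, so equal sums force equal
    summands; nested finite sets of equal cardinality coincide.\<close>
  have C_eq: "C t = C u" if "t \<le> u" "g t = g u" for t u
  proof -
    have sub: "L t \<subseteq> L u" "R t \<subseteq> R u"
      using \<open>t \<le> u\<close> by (auto simp: L_def R_def)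
    have "card (L t) \<le> card (L u)" "card (R t) \<le> card (R u)"
      using sub finL finR by (auto intro: card_mono)
    with \<open>g t = g u\<close> have "card (L t) = card (L u)" "card (R t) = card (R u)"
      by (auto simp: g_def)
    with sub have "L t = L u" "R t = R u"
      using finL finR card_subset_eq by blast+
    then show ?thesis
      by (simp add: CLR)
  qed
  \<comment> \<open>A nonempty \<open>C t\<close> makes \<open>R t\<close> a proper subset of
    \<open>L t\<close>. Hence \<open>card (R t) < card (L t)\<close>, and \<open>card (L t)\<close>
    is at most \<open>card A\<close>, which excludes the values 0 and \<open>2 * card A\<close> of
    \<open>g\<close>.\<close>
  have g_range: "g t \<in> {1..2 * card A - 1}" if "t \<in> T" for t
  proof -
    have "R t \<subseteq> L t"
      using lr by (auto simp: L_def R_def intro: order_trans less_imp_le)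
    moreover have "L t - R t \<noteq> {}"
      using that by (simp add: T_def CLR)
    ultimately have "R t \<subset> L t"
      by blast
    then have "card (R t) < card (L t)"
      using finL by (rule psubset_card_mono[rotated])
    moreover have "card (L t) \<le> card A"
      using fin by (auto simp: L_def intro: card_mono)
    ultimately show ?thesis
      by (auto simp: g_def)
  qed
  \<comment> \<open>\<open>C\<close> factors through \<open>g\<close>: send each value of
    \<open>g\<close> to the set at an arbitrarily chosen point with that value.
    \<open>linear\<close> provides the order of the two points that \<open>C_eq\<close> asks
    for.\<close>
  have "\<exists>h. \<forall>t\<in>T. C t = h (g t)"
  proof (intro exI ballI)
    fix t
    assume "t \<in> T"
    have "g (SOME u. g u = g t) = g t"
      by (rule someI[of _ t]) simp
    then show "C t = (\<lambda>n. C (SOME u. g u = n)) (g t)"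
      using C_eq by (metis linear)
  qed
  then obtain h where "\<And>t. t \<in> T \<Longrightarrow> C t = h (g t)"
    by blast
  with g_range S have sub: "\<S> \<subseteq> h ` {1..2 * card A - 1}"
    by auto
  then show "finite \<S>"
    by (rule finite_subset) simp
  have "card \<S> \<le> card (h ` {1..2 * card A - 1})"
    using sub by (intro card_mono) auto
  also have "\<dots> \<le> 2 * card A - 1"
    using card_image_le[of "{1..2 * card A - 1}" h] by simp
  finally show "card \<S> \<le> 2 * card A - 1" .
qed

text \<open>Completing the square: with total weight \<open>W\<close> and weighted mean
  \<open>m\<close>, the cost at \<open>t\<close> exceeds the cost at \<open>m\<close> by exactly
  \<open>W * (t - m)\<^sup>2\<close>.\<close>

lemma weighted_least_squares_mean:
  fixes w x :: "'a \<Rightarrow> real"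
  assumes "(\<Sum>k\<in>A. w k) > 0"
  shows "(\<Sum>k\<in>A. w k * (inverse (\<Sum>k\<in>A. w k) * (\<Sum>k\<in>A. w k * x k) - x k)\<^sup>2)
    \<le> (\<Sum>k\<in>A. w k * (t - x k)\<^sup>2)"
proof -
  define W where "W = (\<Sum>k\<in>A. w k)"
  define S where "S = (\<Sum>k\<in>A. w k * x k)"
  define m where "m = inverse W * S"
  have expand: "(\<Sum>k\<in>A. w k * (u - x k)\<^sup>2) = W * u\<^sup>2 - 2 * u * S + (\<Sum>k\<in>A. w k * (x k)\<^sup>2)" for u
    by (simp add: W_def S_def power2_diff algebra_simps sum.distrib sum_subtractf
        sum_distrib_left sum_distrib_right)
  have W: "W > 0"
    using assms by (simp add: W_def)
  then have S: "S = W * m"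
    by (simp add: m_def)
  have "(W * t\<^sup>2 - 2 * t * S) - (W * m\<^sup>2 - 2 * m * S) = W * (t - m)\<^sup>2"
    by (simp add: S power2_eq_square algebra_simps)
  moreover have "W * (t - m)\<^sup>2 \<ge> 0"
    using W by simp
  ultimately have "(\<Sum>k\<in>A. w k * (m - x k)\<^sup>2) \<le> (\<Sum>k\<in>A. w k * (t - x k)\<^sup>2)"
    by (simp add: expand)
  then show ?thesis
    by (simp add: m_def W_def S_def)
qed

text \<open>Brings consensus sets into the form counted by \<open>nonempty_stabbing_sets\<close>;
  positivity of \<open>\<alpha> k\<close> and \<open>c\<close> allows taking square roots.\<close>

lemma consensus_set_eq_interval:
  assumes "\<And>k. k \<in> {1..K} \<Longrightarrow> \<alpha> k > 0" and "c > 0"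
  shows "consensus_set K s \<alpha> c t = {k \<in> {1..K}. s k - \<alpha> k * c \<le> t \<and> t \<le> s k + \<alpha> k * c}"
proof -
  have "(t - s k)\<^sup>2 / (\<alpha> k)\<^sup>2 \<le> c\<^sup>2 \<longleftrightarrow> s k - \<alpha> k * c \<le> t \<and> t \<le> s k + \<alpha> k * c" if "k \<in> {1..K}" for k
  proof -
    have a: "\<alpha> k > 0"
      using assms(1) that .
    then have "(t - s k)\<^sup>2 / (\<alpha> k)\<^sup>2 \<le> c\<^sup>2 \<longleftrightarrow> (t - s k)\<^sup>2 \<le> (\<alpha> k * c)\<^sup>2"
      by (simp add: divide_le_eq power_mult_distrib mult.commute)
    also have "\<dots> \<longleftrightarrow> \<bar>t - s k\<bar> \<le> \<alpha> k * c"
      using a assms(2) by (simp add: abs_le_square_iff[symmetric])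
    finally show ?thesis
      by (auto simp: abs_le_iff)
  qed
  then show ?thesis
    by (auto simp: consensus_set_def)
qed

lemma tls_cost_le_max: "tls_cost K s \<alpha> c t \<le> real K * c\<^sup>2"
proof -
  have "tls_cost K s \<alpha> c t \<le> (\<Sum>k=1..K. c\<^sup>2)"
    unfolding tls_cost_def by (rule sum_mono) simp
  then show ?thesis
    by simp
qed

lemma tls_cost_empty_consensus:
  assumes "consensus_set K s \<alpha> c t = {}"
  shows "tls_cost K s \<alpha> c t = real K * c\<^sup>2"
proof -
  have "tls_cost K s \<alpha> c t = (\<Sum>k=1..K. c\<^sup>2)"
    unfolding tls_cost_def using assms
    by (intro sum.cong) (auto simp: consensus_set_def min_def)
  then show ?thesis
    by simp
qed

lemma tls_cost_consensus_estimate_le: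
  assumes "\<And>k. k \<in> {1..K} \<Longrightarrow> \<alpha> k > 0" and ne: "consensus_set K s \<alpha> c t \<noteq> {}"
  shows "tls_cost K s \<alpha> c (consensus_estimate s \<alpha> (consensus_set K s \<alpha> c t)) \<le> tls_cost K s \<alpha> c t"
proof -
  define A where "A = consensus_set K s \<alpha> c t"
  define e where "e = consensus_estimate s \<alpha> A"
  define B where "B = {1..K} - A"
  have A: "A \<subseteq> {1..K}" "finite A"
    by (auto simp: A_def consensus_set_def)
  have split: "tls_cost K s \<alpha> c u = (\<Sum>k\<in>A. min ((u - s k)\<^sup>2 / (\<alpha> k)\<^sup>2) (c\<^sup>2))
      + (\<Sum>k\<in>B. min ((u - s k)\<^sup>2 / (\<alpha> k)\<^sup>2) (c\<^sup>2))" for u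
    using A sum.subset_diff[of A "{1..K}"] by (simp add: tls_cost_def B_def add.commute)
  have pos: "(\<Sum>k\<in>A. 1 / (\<alpha> k)\<^sup>2) > 0"
  proof (rule sum_pos)
    show "1 / (\<alpha> k)\<^sup>2 > 0" if "k \<in> A" for k
      using assms(1)[of k] A that by auto
  qed (use A ne in \<open>auto simp: A_def\<close>)
  have "(\<Sum>k\<in>A. min ((e - s k)\<^sup>2 / (\<alpha> k)\<^sup>2) (c\<^sup>2)) \<le> (\<Sum>k\<in>A. (e - s k)\<^sup>2 / (\<alpha> k)\<^sup>2)"
    by (rule sum_mono) simp
  also have "\<dots> \<le> (\<Sum>k\<in>A. (t - s k)\<^sup>2 / (\<alpha> k)\<^sup>2)"
    using weighted_least_squares_mean[OF pos, of s t] by (simp add: e_def consensus_estimate_def)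
  \<comment> \<open>The truncation is inactive at \<open>t\<close> for the indices in its own
    consensus set.\<close>
  also have "\<dots> = (\<Sum>k\<in>A. min ((t - s k)\<^sup>2 / (\<alpha> k)\<^sup>2) (c\<^sup>2))"
    by (intro sum.cong) (auto simp: A_def consensus_set_def)
  finally have 1: "(\<Sum>k\<in>A. min ((e - s k)\<^sup>2 / (\<alpha> k)\<^sup>2) (c\<^sup>2)) \<le> \<dots>" .
  \<comment> \<open>Outside the consensus set, the terms at \<open>t\<close> already have the
    largest possible value \<open>c\<^sup>2\<close>.\<close>
  have 2: "(\<Sum>k\<in>B. min ((e - s k)\<^sup>2 / (\<alpha> k)\<^sup>2) (c\<^sup>2)) \<le> (\<Sum>k\<in>B. min ((t - s k)\<^sup>2 / (\<alpha> k)\<^sup>2) (c\<^sup>2))"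
    by (rule sum_mono) (auto simp: B_def A_def consensus_set_def)
  show ?thesis
    using 1 2 by (simp add: split flip: A_def e_def)
qed

text \<open>A point with empty consensus set yields no candidate of its own, but its cost is the
  upper bound \<open>real K * c\<^sup>2\<close>, so any candidate does at least as well.\<close>

lemma ex_consensus_estimate_le:
  assumes "\<And>k. k \<in> {1..K} \<Longrightarrow> \<alpha> k > 0" and "consensus_sets K s \<alpha> c \<noteq> {}"
  shows "\<exists>A\<in>consensus_sets K s \<alpha> c.
    tls_cost K s \<alpha> c (consensus_estimate s \<alpha> A) \<le> tls_cost K s \<alpha> c t"
proof (cases "consensus_set K s \<alpha> c t = {}")
  case True
  then show ?thesis
    using assms(2) tls_cost_le_max by (auto simp: tls_cost_empty_consensus)
next
  case False
  then show ?thesis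
    using tls_cost_consensus_estimate_le[of K \<alpha> s c t] assms(1)
    by (intro bexI[of _ "consensus_set K s \<alpha> c t"]) (auto simp: consensus_sets_def)
qed

theorem theorem7:
  fixes K :: nat and s \<alpha> :: "nat \<Rightarrow> real" and c :: real
  assumes "K \<ge> 1"
    and "\<And>k. k \<in> {1..K} \<Longrightarrow> \<alpha> k > 0"
    and "c > 0"
  shows "finite (consensus_sets K s \<alpha> c) \<and>
    card (consensus_sets K s \<alpha> c) \<le> 2 * K - 1 \<and>
    (\<exists>I :: nat \<Rightarrow> nat set. I ` {1..2 * K - 1} = consensus_sets K s \<alpha> c) \<and>
    (\<forall>I :: nat \<Rightarrow> nat set. I ` {1..2 * K - 1} = consensus_sets K s \<alpha> c \<longrightarrow>
      (\<exists>s_hat. is_arg_min (tls_cost K s \<alpha> c)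
         (\<lambda>t. \<exists>i\<in>{1..2 * K - 1}. t = consensus_estimate s \<alpha> (I i)) s_hat) \<and>
      (\<forall>s_hat. is_arg_min (tls_cost K s \<alpha> c)
         (\<lambda>t. \<exists>i\<in>{1..2 * K - 1}. t = consensus_estimate s \<alpha> (I i)) s_hat \<longrightarrow>
         is_arg_min (tls_cost K s \<alpha> c) (\<lambda>t. t \<in> (UNIV :: real set)) s_hat))"
proof -
  let ?f = "tls_cost K s \<alpha> c"
  let ?CS = "consensus_sets K s \<alpha> c"
  have CS: "?CS = {C. C \<noteq> {} \<and> (\<exists>t. C = {k \<in> {1..K}. s k - \<alpha> k * c \<le> t \<and> t \<le> s k + \<alpha> k * c})}"
    unfolding consensus_sets_def using consensus_set_eq_interval[of K \<alpha> c s] assms(2,3) by simp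
  have lr: "s k - \<alpha> k * c \<le> s k + \<alpha> k * c" if "k \<in> {1..K}" for k
    using assms(2)[OF that] assms(3) by (simp add: mult_nonneg_nonneg)
  have fin: "finite ?CS"
    unfolding CS by (rule nonempty_stabbing_sets(1)) (use lr in auto)
  have "card ?CS \<le> 2 * card {1..K} - 1"
    unfolding CS by (rule nonempty_stabbing_sets(2)) (use lr in auto)
  then have card: "card ?CS \<le> 2 * K - 1"
    by simp
  \<comment> \<open>At \<open>s 1\<close> the first residual vanishes, so at least one candidate
    exists.\<close>
  have "1 \<in> consensus_set K s \<alpha> c (s 1)"
    using assms(1) by (simp add: consensus_set_def)
  then have ne: "?CS \<noteq> {}"
    by (auto simp: consensus_sets_def)
  have "\<exists>I :: nat \<Rightarrow> nat set. I ` {1..2 * K - 1} = ?CS"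
  proof -
    obtain h where h: "inj_on h ?CS" "h ` ?CS \<subseteq> {1..2 * K - 1}"
      using card_le_inj[OF fin, of "{1..2 * K - 1}"] card by auto
    obtain A where "A \<in> ?CS"
      using ne by blast
    \<comment> \<open>Invert the injection into the index range; the surplus indices all name
      \<open>A\<close>, which accounts for the repetitions.\<close>
    with h have "(\<lambda>n. if n \<in> h ` ?CS then inv_into ?CS h n else A) ` {1..2 * K - 1} = ?CS"
      by (force simp: inv_into_into intro: rev_image_eqI)
    then show ?thesis
      by blast
  qed
  moreover have "(\<exists>s_hat. is_arg_min ?f (\<lambda>t. \<exists>i\<in>{1..2 * K - 1}. t = consensus_estimate s \<alpha> (I i)) s_hat) \<and>
      (\<forall>s_hat. is_arg_min ?f (\<lambda>t. \<exists>i\<in>{1..2 * K - 1}. t = consensus_estimate s \<alpha> (I i)) s_hat \<longrightarrow>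
         is_arg_min ?f (\<lambda>t. t \<in> (UNIV :: real set)) s_hat)"
    if I: "I ` {1..2 * K - 1} = ?CS" for I :: "nat \<Rightarrow> nat set"
  proof -
    \<comment> \<open>The candidates depend only on the range of \<open>I\<close>, so the choice of
      enumeration drops out and finiteness of the family gives a minimizer.\<close>
    have cand: "(\<exists>i\<in>{1..2 * K - 1}. t = consensus_estimate s \<alpha> (I i))
        \<longleftrightarrow> t \<in> consensus_estimate s \<alpha> ` ?CS" for t
      unfolding I[symmetric] by auto
    have "\<exists>x. is_arg_min ?f (\<lambda>t. t \<in> consensus_estimate s \<alpha> ` ?CS) x"
      using fin ne by (intro ex_is_arg_min_if_finite) auto
    moreover have "is_arg_min ?f (\<lambda>t. t \<in> UNIV) x"
      if "is_arg_min ?f (\<lambda>t. t \<in> consensus_estimate s \<alpha> ` ?CS) x" for x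
      using that ex_consensus_estimate_le[OF assms(2) ne]
      by (auto simp: is_arg_min_linorder intro: order_trans)
    ultimately show ?thesis
      unfolding cand by blast
  qed
  ultimately show ?thesis
    using fin card by blast
qed

end
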